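(* Let $\mathsf{C}$ be a small category and let $\mathcal{N}_{\mathsf{C}}$ be its nerve, whose $n$-simplices are the functors $[n]\to\mathsf{C}$, i.e. sequences $a_0\xrightarrow{f_1}\cdots\xrightarrow{f_n}a_n$ of composable morphisms, with simplicial structure given by precomposition. For a $k$-composable pair $$A=(a_0\xrightarrow{f_1}\cdots\xrightarrow{f_m}a_m)\in\mathcal{N}_{\mathsf{C}}(m),\qquad B=(a_{m-k}\xrightarrow{f_{m-k+1}}\cdots\xrightarrow{f_{m+n-k}}a_{m+n-k})\in\mathcal{N}_{\mathsf{C}}(n)$$ define $$A\circ_k B:=(a_0\xrightarrow{f_1}\cdots\xrightarrow{f_{m+n-k}}a_{m+n-k})\in\mathcal{N}_{\mathsf{C}}(m+n-k).$$ With these definitions, $\mathcal{N}_{\mathsf{C}}$ is a compository.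
   Context: **Simplicial conventions.** $\mathbb{N}$ includes $0$. $\Delta$ is the category of nonempty finite ordinals $[n]=\{0,\dots,n\}$ and order-preserving maps. A simplicial set is a functor $\mathcal{C}:\Delta^{\mathrm{op}}\to\mathbf{Set}$; write $\mathcal{C}(n)=\mathcal{C}([n])$, and for $f:[m]\to[n]$ and $A\in\mathcal{C}(n)$ write $Af:=\mathcal{C}(f)(A)\in\mathcal{C}(m)$. The map $\partial_k:[n-1]\to[n]$ is the injective order-preserving map omitting $k$; $\eta_k:[n+1]\to[n]$ is the surjective order-preserving map hitting $k$ twice. For $k\le n$, $s_k:[k]\to[n]$ is $v\mapsto v$ and $t_k:[k]\to[n]$ is $v\mapsto v+n-k$; the codomain index $n$ is left implicit. **Compositories.** A pair $(A,B)\in\mathcal{C}(m)\times\mathcal{C}(n)$ is $k$-composable ($k\le m,n$) if $At_k=Bs_k$. A compository is a simplicial set $\mathcal{C}$ with an element $A\circ_k B\in\mathcal{C}(m+n-k)$ for every $k\in\mathbb{N}$ and every $k$-composable pair $(A,B)\in\mathcal{C}(m)\times\mathcal{C}(n)$, such that: 1. (Identity) $As_k\circ_k A=A$ and $A\circ_k At_k=A$. And for every $k$-composable $(A,B)\in\mathcal{C}(m)\times\mathcal{C}(n)$: 2. (Back-and-forth) $(A\circ_k B)s_{m+i}\circ_{k+i}B=A\circ_k B$ for $0\le i\le n-k$; $A\circ_{k+j}(A\circ_k B)t_{n+j}=A\circ_k B$ for $0\le j\le m-k$. 3. (Degeneracies) $(A\circ_k B)\eta_i=A\eta_i\circ_k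 B$ for $i\le m-k$; $(A\circ_k B)\eta_i=A\circ_k B\eta_{i-m+k}$ for $i\ge m$; $(A\circ_k B)\eta_i=A\eta_i\circ_{k+1}B\eta_{i-m+k}$ for $m-k\le i\le m$. 4. (Faces) $(A\circ_k B)\partial_i=A\partial_i\circ_k B$ for $i<m-k$; $(A\circ_k B)\partial_i=A\circ_k B\partial_{i-m+k}$ for $i>m$. *)

theory Defs
  imports Main "HOL-Library.FuncSet"
begin

section \<open>Small categories and functors\<close>

record ('o, 'm) cat =
  Ob :: "'o set"
  Arr :: "'m set"
  Dom :: "'m \<Rightarrow> 'o"
  Cod :: "'m \<Rightarrow> 'o"
  Ident :: "'o \<Rightarrow> 'm"
  Comp :: "'m \<Rightarrow> 'm \<Rightarrow> 'm"

text \<open>\<open>Comp C g f\<close> is the composite \<open>g \<circ> f\<close>; it is meaningful when \<open>Cod C f = Dom C g\<close>.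
  Smallness holds by construction, as \<open>Ob C\<close> and \<open>Arr C\<close> are sets.\<close>

locale small_category =
  fixes C :: "('o, 'm) cat"
  assumes dom_in: "f \<in> Arr C \<Longrightarrow> Dom C f \<in> Ob C"
    and cod_in: "f \<in> Arr C \<Longrightarrow> Cod C f \<in> Ob C"
    and ident_in: "a \<in> Ob C \<Longrightarrow> Ident C a \<in> Arr C"
    and dom_ident: "a \<in> Ob C \<Longrightarrow> Dom C (Ident C a) = a"
    and cod_ident: "a \<in> Ob C \<Longrightarrow> Cod C (Ident C a) = a"
    and comp_in: "\<lbrakk>f \<in> Arr C; g \<in> Arr C; Cod C f = Dom C g\<rbrakk> \<Longrightarrow> Comp C g f \<in> Arr C"
    and dom_comp: "\<lbrakk>f \<in> Arr C; g \<in> Arr C; Cod C f = Dom C g\<rbrakk> \<Longrightarrow> Dom C (Comp C g f) = Dom C f"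
    and cod_comp: "\<lbrakk>f \<in> Arr C; g \<in> Arr C; Cod C f = Dom C g\<rbrakk> \<Longrightarrow> Cod C (Comp C g f) = Cod C g"
    and comp_ident_right: "f \<in> Arr C \<Longrightarrow> Comp C f (Ident C (Dom C f)) = f"
    and comp_ident_left: "f \<in> Arr C \<Longrightarrow> Comp C (Ident C (Cod C f)) f = f"
    and comp_assoc: "\<lbrakk>f \<in> Arr C; g \<in> Arr C; h \<in> Arr C; Cod C f = Dom C g; Cod C g = Dom C h\<rbrakk>
      \<Longrightarrow> Comp C h (Comp C g f) = Comp C (Comp C h g) f"

record ('o, 'm, 'p, 'q) func =
  on_ob :: "'o \<Rightarrow> 'p"
  on_arr :: "'m \<Rightarrow> 'q"

text \<open>Both maps are extensional, so that equality in HOL is equality of functors.\<close>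

definition functors :: "('o, 'm) cat \<Rightarrow> ('p, 'q) cat \<Rightarrow> ('o, 'm, 'p, 'q) func set" where
  "functors C D = {F.
     on_ob F \<in> Ob C \<rightarrow>\<^sub>E Ob D \<and>
     on_arr F \<in> Arr C \<rightarrow>\<^sub>E Arr D \<and>
     (\<forall>f\<in>Arr C. Dom D (on_arr F f) = on_ob F (Dom C f)) \<and>
     (\<forall>f\<in>Arr C. Cod D (on_arr F f) = on_ob F (Cod C f)) \<and>
     (\<forall>a\<in>Ob C. on_arr F (Ident C a) = Ident D (on_ob F a)) \<and>
     (\<forall>f\<in>Arr C. \<forall>g\<in>Arr C. Cod C f = Dom C g \<longrightarrow>
        on_arr F (Comp C g f) = Comp D (on_arr F g) (on_arr F f))}"

definition func_comp ::
  "('o, 'm) cat \<Rightarrow> ('p, 'q, 'r, 's) func \<Rightarrow> ('o, 'm, 'p, 'q) func \<Rightarrow> ('o, 'm, 'r, 's) func" where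
  "func_comp C G F =
     \<lparr>on_ob = compose (Ob C) (on_ob G) (on_ob F), on_arr = compose (Arr C) (on_arr G) (on_arr F)\<rparr>"


section \<open>The simplex category and simplicial sets\<close>

text \<open>Morphisms \<open>[m] \<rightarrow> [n]\<close> of the simplex category are extensional monotone functions on
  \<open>{0..m}\<close>, composed with \<^const>\<open>compose\<close>.\<close>

definition simplex_maps :: "nat \<Rightarrow> nat \<Rightarrow> (nat \<Rightarrow> nat) set" where
  "simplex_maps m n = {f \<in> {0..m} \<rightarrow>\<^sub>E {0..n}. mono_on {0..m} f}"

text \<open>\<open>face n k : [n - 1] \<rightarrow> [n]\<close> (for \<open>n \<ge> 1\<close>) and \<open>degen n k : [n + 1] \<rightarrow> [n]\<close> are the maps
  \<open>\<partial>\<^sub>k\<close> and \<open>\<eta>\<^sub>k\<close>; \<open>initial k : [k] \<rightarrow> [n]\<close> and \<open>final n k : [k] \<rightarrow> [n]\<close> are \<open>s\<^sub>k\<close> and \<open>t\<^sub>k\<close>.\<close>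

definition face :: "nat \<Rightarrow> nat \<Rightarrow> nat \<Rightarrow> nat" where
  "face n k = (\<lambda>v\<in>{0..n - 1}. if v < k then v else v + 1)"

definition degen :: "nat \<Rightarrow> nat \<Rightarrow> nat \<Rightarrow> nat" where
  "degen n k = (\<lambda>v\<in>{0..n + 1}. if v \<le> k then v else v - 1)"

definition initial :: "nat \<Rightarrow> nat \<Rightarrow> nat" where
  "initial k = (\<lambda>v\<in>{0..k}. v)"

definition final :: "nat \<Rightarrow> nat \<Rightarrow> nat \<Rightarrow> nat" where
  "final n k = (\<lambda>v\<in>{0..k}. v + (n - k))"

text \<open>\<open>X n\<close> is the set of \<open>n\<close>-simplices, and \<open>act m n f A\<close> is \<open>A f\<close> for \<open>f : [m] \<rightarrow> [n]\<close> and
  \<open>A \<in> X n\<close>. The sets \<open>X n\<close> need not be disjoint, so operations carry the dimensions explicitly.\<close>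

locale simplicial_set =
  fixes X :: "nat \<Rightarrow> 'a set"
    and act :: "nat \<Rightarrow> nat \<Rightarrow> (nat \<Rightarrow> nat) \<Rightarrow> 'a \<Rightarrow> 'a"
  assumes act_in: "\<lbrakk>f \<in> simplex_maps m n; A \<in> X n\<rbrakk> \<Longrightarrow> act m n f A \<in> X m"
    and act_id: "A \<in> X n \<Longrightarrow> act n n (\<lambda>v\<in>{0..n}. v) A = A"
    and act_compose: "\<lbrakk>f \<in> simplex_maps l m; g \<in> simplex_maps m n; A \<in> X n\<rbrakk>
      \<Longrightarrow> act l n (compose {0..l} g f) A = act l m f (act m n g A)"
begin

definition composable :: "nat \<Rightarrow> nat \<Rightarrow> nat \<Rightarrow> 'a \<Rightarrow> 'a \<Rightarrow> bool" where
  "composable m n k A B \<longleftrightarrow> k \<le> m \<and> k \<le> n \<and> A \<in> X m \<and> B \<in> X n \<and>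
     act k m (final m k) A = act k n (initial k) B"

end


section \<open>Compositories\<close>

text \<open>\<open>cmp m n k A B\<close> is \<open>A \<circ>\<^sub>k B\<close> for \<open>A \<in> X m\<close>, \<open>B \<in> X n\<close>. Composition is partial, so an axiom
  equating composites also asserts that those composites are defined; this is what the
  \<open>composable\<close> conjuncts say. The bounds \<open>i \<le> m + n - k\<close> are those under which
  \<open>\<eta>\<^sub>i\<close> and \<open>\<partial>\<^sub>i\<close> exist with codomain \<open>[m + n - k]\<close>. Indices \<open>i - m + k\<close> are written
  \<open>i + k - m\<close> because subtraction on \<^typ>\<open>nat\<close> truncates.\<close>

locale compository = simplicial_set X act
  for X :: "nat \<Rightarrow> 'a set"
    and act :: "nat \<Rightarrow> nat \<Rightarrow> (nat \<Rightarrow> nat) \<Rightarrow> 'a \<Rightarrow> 'a" +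
  fixes cmp :: "nat \<Rightarrow> nat \<Rightarrow> nat \<Rightarrow> 'a \<Rightarrow> 'a \<Rightarrow> 'a"
  assumes cmp_in: "composable m n k A B \<Longrightarrow> cmp m n k A B \<in> X (m + n - k)"
    and identity_left: "\<lbrakk>k \<le> m; A \<in> X m\<rbrakk> \<Longrightarrow>
      composable k m k (act k m (initial k) A) A \<and>
      cmp k m k (act k m (initial k) A) A = A"
    and identity_right: "\<lbrakk>k \<le> m; A \<in> X m\<rbrakk> \<Longrightarrow>
      composable m k k A (act k m (final m k) A) \<and>
      cmp m k k A (act k m (final m k) A) = A"
    and back_and_forth_left: "\<lbrakk>composable m n k A B; i \<le> n - k\<rbrakk> \<Longrightarrow>
      composable (m + i) n (k + i) (act (m + i) (m + n - k) (initial (m + i)) (cmp m n k A B)) B \<and>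
      cmp (m + i) n (k + i) (act (m + i) (m + n - k) (initial (m + i)) (cmp m n k A B)) B =
        cmp m n k A B"
    and back_and_forth_right: "\<lbrakk>composable m n k A B; j \<le> m - k\<rbrakk> \<Longrightarrow>
      composable m (n + j) (k + j) A
        (act (n + j) (m + n - k) (final (m + n - k) (n + j)) (cmp m n k A B)) \<and>
      cmp m (n + j) (k + j) A
        (act (n + j) (m + n - k) (final (m + n - k) (n + j)) (cmp m n k A B)) =
        cmp m n k A B"
    and degen_left: "\<lbrakk>composable m n k A B; i \<le> m - k\<rbrakk> \<Longrightarrow>
      composable (m + 1) n k (act (m + 1) m (degen m i) A) B \<and>
      act (m + n - k + 1) (m + n - k) (degen (m + n - k) i) (cmp m n k A B) =
        cmp (m + 1) n k (act (m + 1) m (degen m i) A) B"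
    and degen_right: "\<lbrakk>composable m n k A B; m \<le> i; i \<le> m + n - k\<rbrakk> \<Longrightarrow>
      composable m (n + 1) k A (act (n + 1) n (degen n (i + k - m)) B) \<and>
      act (m + n - k + 1) (m + n - k) (degen (m + n - k) i) (cmp m n k A B) =
        cmp m (n + 1) k A (act (n + 1) n (degen n (i + k - m)) B)"
    and degen_middle: "\<lbrakk>composable m n k A B; m - k \<le> i; i \<le> m\<rbrakk> \<Longrightarrow>
      composable (m + 1) (n + 1) (k + 1)
        (act (m + 1) m (degen m i) A) (act (n + 1) n (degen n (i + k - m)) B) \<and>
      act (m + n - k + 1) (m + n - k) (degen (m + n - k) i) (cmp m n k A B) =
        cmp (m + 1) (n + 1) (k + 1)
          (act (m + 1) m (degen m i) A) (act (n + 1) n (degen n (i + k - m)) B)"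
    and face_left: "\<lbrakk>composable m n k A B; i < m - k\<rbrakk> \<Longrightarrow>
      composable (m - 1) n k (act (m - 1) m (face m i) A) B \<and>
      act (m + n - k - 1) (m + n - k) (face (m + n - k) i) (cmp m n k A B) =
        cmp (m - 1) n k (act (m - 1) m (face m i) A) B"
    and face_right: "\<lbrakk>composable m n k A B; m < i; i \<le> m + n - k\<rbrakk> \<Longrightarrow>
      composable m (n - 1) k A (act (n - 1) n (face n (i + k - m)) B) \<and>
      act (m + n - k - 1) (m + n - k) (face (m + n - k) i) (cmp m n k A B) =
        cmp m (n - 1) k A (act (n - 1) n (face n (i + k - m)) B)"


section \<open>The nerve\<close>

text \<open>The ordinal \<open>[n]\<close> as a category: the arrow \<open>i \<rightarrow> j\<close> is the pair \<open>(i, j)\<close> with \<open>i \<le> j\<close>.\<close>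

definition ord_cat :: "nat \<Rightarrow> (nat, nat \<times> nat) cat" where
  "ord_cat n = \<lparr>Ob = {0..n}, Arr = {(i, j). i \<le> j \<and> j \<le> n}, Dom = fst, Cod = snd,
     Ident = (\<lambda>i. (i, i)), Comp = (\<lambda>g f. (fst f, snd g))\<rparr>"

definition ord_func :: "nat \<Rightarrow> (nat \<Rightarrow> nat) \<Rightarrow> (nat, nat \<times> nat, nat, nat \<times> nat) func" where
  "ord_func m f =
     \<lparr>on_ob = restrict f (Ob (ord_cat m)), on_arr = (\<lambda>(i, j)\<in>Arr (ord_cat m). (f i, f j))\<rparr>"

type_synonym ('o, 'm) simplex = "(nat, nat \<times> nat, 'o, 'm) func"

definition nerve :: "('o, 'm) cat \<Rightarrow> nat \<Rightarrow> ('o, 'm) simplex set" where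
  "nerve C n = functors (ord_cat n) C"

definition nerve_act ::
  "nat \<Rightarrow> nat \<Rightarrow> (nat \<Rightarrow> nat) \<Rightarrow> ('o, 'm) simplex \<Rightarrow> ('o, 'm) simplex" where
  "nerve_act m n f A = func_comp (ord_cat m) A (ord_func m f)"

text \<open>A simplex \<open>A\<close> is the sequence with objects \<open>a\<^sub>i = on_ob A i\<close> and arrows
  \<open>f\<^sub>i = step A i : a\<^bsub>i-1\<^esub> \<rightarrow> a\<^sub>i\<close> for \<open>i \<ge> 1\<close>; conversely, \<open>seq_func C n a f\<close> is the functor
  \<open>[n] \<rightarrow> C\<close> given by a sequence, sending \<open>(i, j)\<close> to \<open>f\<^sub>j \<circ> \<dots> \<circ> f\<^bsub>i+1\<^esub>\<close>.\<close>

definition step :: "('o, 'm) simplex \<Rightarrow> nat \<Rightarrow> 'm" where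
  "step A i = on_arr A (i - 1, i)"

fun path_comp :: "('o, 'm) cat \<Rightarrow> (nat \<Rightarrow> 'o) \<Rightarrow> (nat \<Rightarrow> 'm) \<Rightarrow> nat \<Rightarrow> nat \<Rightarrow> 'm" where
  "path_comp C a f i 0 = Ident C (a i)"
| "path_comp C a f i (Suc l) = Comp C (f (i + Suc l)) (path_comp C a f i l)"

definition seq_func ::
  "('o, 'm) cat \<Rightarrow> nat \<Rightarrow> (nat \<Rightarrow> 'o) \<Rightarrow> (nat \<Rightarrow> 'm) \<Rightarrow> ('o, 'm) simplex" where
  "seq_func C n a f =
     \<lparr>on_ob = restrict a (Ob (ord_cat n)),
      on_arr = (\<lambda>(i, j)\<in>Arr (ord_cat n). path_comp C a f i (j - i))\<rparr>"

text \<open>The two descriptions of simplices agree.\<close>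

lemma seq_func_of_simplex:
  assumes A: "A \<in> nerve C n"
  shows "seq_func C n (on_ob A) (step A) = A"
proof -
  have path: "path_comp C (on_ob A) (step A) i l = on_arr A (i, i + l)" if "i + l \<le> n" for i l
    using that
  proof (induction l)
    case 0
    have "i \<in> Ob (ord_cat n)" using 0 by (simp add: ord_cat_def)
    then have "on_arr A (Ident (ord_cat n) i) = Ident C (on_ob A i)"
      using A unfolding nerve_def functors_def by blast
    then show ?case by (simp add: ord_cat_def)
  next
    case (Suc l)
    let ?f = "(i, i + l)" and ?g = "(i + l, i + Suc l)"
    have "?f \<in> Arr (ord_cat n)" "?g \<in> Arr (ord_cat n)" "Cod (ord_cat n) ?f = Dom (ord_cat n) ?g"
      using Suc.prems by (simp_all add: ord_cat_def)
    then have "on_arr A (Comp (ord_cat n) ?g ?f) = Comp C (on_arr A ?g) (on_arr A ?f)"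
      using A unfolding nerve_def functors_def by blast
    then show ?case using Suc by (simp add: ord_cat_def step_def)
  qed
  have ext: "on_ob A \<in> extensional (Ob (ord_cat n))" "on_arr A \<in> extensional (Arr (ord_cat n))"
    using A by (auto simp: nerve_def functors_def PiE_def)
  have "on_arr (seq_func C n (on_ob A) (step A)) = on_arr A"
  proof
    fix p :: "nat \<times> nat"
    obtain i j where p: "p = (i, j)" by (cases p)
    show "on_arr (seq_func C n (on_ob A) (step A)) p = on_arr A p"
    proof (cases "p \<in> Arr (ord_cat n)")
      case True
      then show ?thesis using path[of i "j - i"] p by (simp add: seq_func_def ord_cat_def)
    next
      case False
      then show ?thesis using ext(2) p by (simp add: seq_func_def extensional_def)
    qed
  qed
  moreover have "on_ob (seq_func C n (on_ob A) (step A)) = on_ob A"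
    using ext(1) by (simp add: seq_func_def extensional_restrict)
  ultimately show ?thesis by simp
qed

lemma (in small_category) seq_func_in_nerve:
  assumes a: "\<And>i. i \<le> n \<Longrightarrow> a i \<in> Ob C"
    and f: "\<And>i. \<lbrakk>1 \<le> i; i \<le> n\<rbrakk> \<Longrightarrow> f i \<in> Arr C \<and> Dom C (f i) = a (i - 1) \<and> Cod C (f i) = a i"
  shows "seq_func C n a f \<in> nerve C n"
    and "i \<le> n \<Longrightarrow> on_ob (seq_func C n a f) i = a i"
    and "\<lbrakk>1 \<le> i; i \<le> n\<rbrakk> \<Longrightarrow> step (seq_func C n a f) i = f i"
proof -
  have path: "path_comp C a f i l \<in> Arr C \<and> Dom C (path_comp C a f i l) = a i \<and>
      Cod C (path_comp C a f i l) = a (i + l)" if "i + l \<le> n" for i l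
    using that
  proof (induction l)
    case 0
    then show ?case using a[of i] by (simp add: ident_in dom_ident cod_ident)
  next
    case (Suc l)
    then show ?case using f[of "i + Suc l"] by (simp add: comp_in dom_comp cod_comp)
  qed
  have path_add: "path_comp C a f i (l + l') = Comp C (path_comp C a f (i + l) l') (path_comp C a f i l)"
    if "i + l + l' \<le> n" for i l l'
    using that
  proof (induction l')
    case 0
    then have "Comp C (Ident C (a (i + l))) (path_comp C a f i l) = path_comp C a f i l"
      using path[of i l] comp_ident_left[of "path_comp C a f i l"] by simp
    then show ?case by simp
  next
    case (Suc l')
    show ?case
      using Suc f[of "i + l + Suc l'"] path[of i l] path[of "i + l" l']
        comp_assoc[of "path_comp C a f i l" "path_comp C a f (i + l) l'" "f (i + l + Suc l')"]
      by (simp add: add.assoc)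
  qed
  have comp: "path_comp C a f i (k - i) = Comp C (path_comp C a f j (k - j)) (path_comp C a f i (j - i))"
    if "i \<le> j" "j \<le> k" "k \<le> n" for i j k
    using path_add[of i "j - i" "k - j"] that by simp
  have arr: "path_comp C a f i (j - i) \<in> Arr C \<and> Dom C (path_comp C a f i (j - i)) = a i \<and>
      Cod C (path_comp C a f i (j - i)) = a j" if "i \<le> j" "j \<le> n" for i j
    using path[of i "j - i"] that by simp
  show "seq_func C n a f \<in> nerve C n"
    unfolding nerve_def functors_def mem_Collect_eq
  proof (intro conjI ballI impI)
    fix p q
    assume pq: "p \<in> Arr (ord_cat n)" "q \<in> Arr (ord_cat n)" "Cod (ord_cat n) p = Dom (ord_cat n) q"
    then obtain i j k where "p = (i, j)" "q = (j, k)" "i \<le> j" "j \<le> k" "k \<le> n"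
      by (cases p, cases q) (simp add: ord_cat_def)
    then show "on_arr (seq_func C n a f) (Comp (ord_cat n) q p) =
        Comp C (on_arr (seq_func C n a f) q) (on_arr (seq_func C n a f) p)"
      using comp[of i j k] by (simp add: seq_func_def ord_cat_def)
  qed (use a arr in \<open>simp_all add: seq_func_def ord_cat_def split_beta\<close>)
  show "on_ob (seq_func C n a f) i = a i" if "i \<le> n"
    using that by (simp add: seq_func_def ord_cat_def)
  show "step (seq_func C n a f) i = f i" if "1 \<le> i" "i \<le> n"
  proof -
    obtain j where j: "i = Suc j" using \<open>1 \<le> i\<close> by (cases i) simp_all
    then show ?thesis using that f[of i] comp_ident_right[of "f i"]
      by (simp add: step_def seq_func_def ord_cat_def)
  qed
qed

text \<open>Position \<open>i > m\<close> of the composite sequence is position \<open>i - (m - k)\<close> of \<open>B\<close>; on the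
  overlap \<open>m - k \<le> i \<le> m\<close> a composable pair agrees.\<close>

definition nerve_cmp :: "('o, 'm) cat \<Rightarrow> nat \<Rightarrow> nat \<Rightarrow> nat \<Rightarrow>
    ('o, 'm) simplex \<Rightarrow> ('o, 'm) simplex \<Rightarrow> ('o, 'm) simplex" where
  "nerve_cmp C m n k A B = seq_func C (m + n - k)
     (\<lambda>i. if i \<le> m then on_ob A i else on_ob B (i - (m - k)))
     (\<lambda>i. if i \<le> m then step A i else step B (i - (m - k)))"

end

theory Submission
  imports Defs
begin

text \<open>The nerve is a compository because composable pairs in it have a \<^emph>\<open>unique gluing\<close>: a
  simplex \<open>D\<close> of dimension \<open>m + n - k\<close> is a string of \<open>m + n - k\<close> arrows, and the initial \<open>m\<close> and
  the final \<open>n\<close> of them cover the string. So \<open>D\<close> is determined by its restrictions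
  \<open>D s\<^sub>m\<close> and \<open>D t\<^sub>n\<close> (\<open>nerve_glue_unique\<close>), and conversely two strings that agree on the
  \<open>k + 1\<close> shared vertices and the \<open>k\<close> arrows between them can be concatenated. Hence \<open>A \<circ>\<^sub>k B\<close>
  is the one simplex that restricts to \<open>A\<close> and to \<open>B\<close> (\<open>nerve_cmp_glues\<close>).

  Every simplicial set with unique gluings is a compository. Indeed, for any simplex \<open>D\<close> of
  dimension \<open>m + n - k\<close> the pair \<open>(D s\<^sub>m, D t\<^sub>n)\<close> is composable, since both ways of restricting
  \<open>D\<close> to the overlap are given by \<open>v \<mapsto> v + (m - k)\<close>, and uniqueness makes \<open>D\<close> its composite
  (\<open>cmp_eqI\<close>). An axiom that claims \<open>D = A' \<circ>\<^bsub>k'\<^esub> B'\<close> thus only asks to verify that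
  \<open>A'\<close> and \<open>B'\<close> are the two restrictions of \<open>D\<close>. When \<open>D\<close> is \<open>(A \<circ>\<^sub>k B) f\<close> for a face or
  degeneracy \<open>f\<close>, this means commuting \<open>f\<close> past \<open>s\<close> and \<open>t\<close>, an identity between explicit maps of
  ordinals.\<close>

section \<open>Maps of ordinals\<close>

lemma initial_in_simplex_maps: "k \<le> n \<Longrightarrow> initial k \<in> simplex_maps k n"
  by (auto simp: simplex_maps_def initial_def mono_on_def)

lemma final_in_simplex_maps: "k \<le> n \<Longrightarrow> final n k \<in> simplex_maps k n"
  by (auto simp: simplex_maps_def final_def mono_on_def)

lemma degen_in_simplex_maps: "i \<le> n \<Longrightarrow> degen n i \<in> simplex_maps (n + 1) n"
  by (auto simp: simplex_maps_def degen_def mono_on_def)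

lemma face_in_simplex_maps: "1 \<le> n \<Longrightarrow> face n i \<in> simplex_maps (n - 1) n"
  by (auto simp: simplex_maps_def face_def mono_on_def)

lemmas simplex_maps_intros =
  initial_in_simplex_maps final_in_simplex_maps degen_in_simplex_maps face_in_simplex_maps

lemmas ordinal_map_defs = initial_def final_def degen_def face_def

lemma simplex_maps_le: "f \<in> simplex_maps m n \<Longrightarrow> v \<le> m \<Longrightarrow> f v \<le> n"
  by (auto simp: simplex_maps_def PiE_def Pi_def)

lemma simplex_maps_mono: "f \<in> simplex_maps m n \<Longrightarrow> v \<le> w \<Longrightarrow> w \<le> m \<Longrightarrow> f v \<le> f w"
  by (auto simp: simplex_maps_def mono_on_def)

lemma simplex_maps_eqI:
  assumes "f \<in> simplex_maps m n" "g \<in> simplex_maps m n" "\<And>v. v \<le> m \<Longrightarrow> f v = g v"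
  shows "f = g"
  using assms by (intro extensionalityI[of _ "{0..m}"]) (auto simp: simplex_maps_def PiE_def)

lemma compose_in_simplex_maps:
  assumes "f \<in> simplex_maps l m" "g \<in> simplex_maps m n"
  shows "compose {0..l} g f \<in> simplex_maps l n"
  using simplex_maps_le[OF assms(1)] simplex_maps_mono[OF assms(1)]
    simplex_maps_le[OF assms(2)] simplex_maps_mono[OF assms(2)]
  by (auto simp: simplex_maps_def mono_on_def compose_def)

section \<open>Simplicial sets with unique gluings\<close>

context simplicial_set
begin

lemma act_act:
  assumes "g \<in> simplex_maps l p" "f \<in> simplex_maps p n" "h \<in> simplex_maps l n" "D \<in> X n"
    and "\<And>v. v \<le> l \<Longrightarrow> f (g v) = h v"
  shows "act l p g (act p n f D) = act l n h D"
proof -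
  have "compose {0..l} f g = h"
    using assms by (intro simplex_maps_eqI[OF compose_in_simplex_maps]) (auto simp: compose_eq)
  then show ?thesis using act_compose[OF assms(1,2,4)] by simp
qed

lemma act_square:
  assumes "g \<in> simplex_maps l p" "f \<in> simplex_maps p n"
    and "g' \<in> simplex_maps l q" "f' \<in> simplex_maps q n" "D \<in> X n"
    and "\<And>v. v \<le> l \<Longrightarrow> f (g v) = f' (g' v)"
  shows "act l p g (act p n f D) = act l q g' (act q n f' D)"
proof -
  have "act l p g (act p n f D) = act l n (compose {0..l} f' g') D"
    using assms by (intro act_act compose_in_simplex_maps) (auto simp: compose_eq)
  then show ?thesis using act_compose[OF assms(3-5)] by simp
qed

lemma act_initial_full: "D \<in> X n \<Longrightarrow> act n n (initial n) D = D"
  by (simp add: initial_def act_id)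

lemma act_final_full: "D \<in> X n \<Longrightarrow> act n n (final n n) D = D"
  by (simp add: final_def act_id)

end

text \<open>The dimension of the glued simplex is a variable \<open>N\<close> with \<open>N + k = m + n\<close>, which avoids
  rewriting truncated differences when the axioms shift \<open>m\<close>, \<open>n\<close> and \<open>k\<close>.\<close>

locale unique_gluing = simplicial_set X act
  for X :: "nat \<Rightarrow> 'a set"
    and act :: "nat \<Rightarrow> nat \<Rightarrow> (nat \<Rightarrow> nat) \<Rightarrow> 'a \<Rightarrow> 'a" +
  fixes cmp :: "nat \<Rightarrow> nat \<Rightarrow> nat \<Rightarrow> 'a \<Rightarrow> 'a \<Rightarrow> 'a"
  assumes glue: "\<lbrakk>composable m n k A B; N + k = m + n\<rbrakk> \<Longrightarrow>
      cmp m n k A B \<in> X N \<and>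
      act m N (initial m) (cmp m n k A B) = A \<and>
      act n N (final N n) (cmp m n k A B) = B"
    and glue_unique: "\<lbrakk>k \<le> m; k \<le> n; N + k = m + n; D \<in> X N; D' \<in> X N;
      act m N (initial m) D = act m N (initial m) D';
      act n N (final N n) D = act n N (final N n) D'\<rbrakk> \<Longrightarrow> D = D'"
begin

text \<open>The two restrictions of \<open>D\<close> form a composable pair because \<open>s\<^sub>m t\<^sub>k\<close> and \<open>t\<^sub>n s\<^sub>k\<close> are the
  same map \<open>[k] \<rightarrow> [m + n - k]\<close>; their composite is then \<open>D\<close> by uniqueness. As the conclusion has
  both parts, it discharges the definedness claims of the axioms along with the equations.\<close>

lemma cmp_eqI:
  assumes k: "k \<le> m" "k \<le> n" and N: "N + k = m + n" and D: "D \<in> X N"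
    and A: "act m N (initial m) D = A" and B: "act n N (final N n) D = B"
  shows "composable m n k A B \<and> cmp m n k A B = D"
proof
  have le: "m \<le> N" "n \<le> N" using k N by auto
  have "A \<in> X m" "B \<in> X n"
    using A B D le by (auto intro: act_in simplex_maps_intros)
  moreover have "act k m (final m k) A = act k n (initial k) B"
    unfolding A[symmetric] B[symmetric]
  proof (rule act_square)
    show "initial m (final m k v) = final N n (initial k v)" if "v \<le> k" for v
    proof -
      have "N - n = m - k" "v + (m - k) \<le> m" using that k N by auto
      then show ?thesis using that k by (simp add: ordinal_map_defs)
    qed
  qed (use k le D in \<open>auto intro: simplex_maps_intros\<close>)
  ultimately show comp: "composable m n k A B"
    using k by (simp add: composable_def)
  show "cmp m n k A B = D"
    using glue[OF comp N] glue_unique[OF k N _ D, of "cmp m n k A B"] A B by simp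
qed

text \<open>A degeneracy or face at \<open>i\<close> of the glued simplex \<open>D\<close> meets the part of \<open>D\<close> coming from \<open>B\<close>
  at \<open>i - (N - n) = i + k - m\<close>, since vertex \<open>v\<close> of \<open>B\<close> is vertex \<open>v + (N - n)\<close> of \<open>D\<close>. On
  either side of the overlap it changes only one of the two parts. A degeneracy inside the
  overlap repeats a vertex of both parts, and so lengthens the overlap as well.\<close>

lemma compository: "compository X act cmp"
proof unfold_locales
  show "cmp m n k A B \<in> X (m + n - k)" if "composable m n k A B" for m n k A B
    using that glue[OF that, of "m + n - k"] by (simp add: composable_def)
next
  show "composable k m k (act k m (initial k) A) A \<and> cmp k m k (act k m (initial k) A) A = A"
    if "k \<le> m" "A \<in> X m" for k m A
    using that by (intro cmp_eqI[where N = m]) (simp_all add: act_initial_full act_final_full)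
next
  show "composable m k k A (act k m (final m k) A) \<and> cmp m k k A (act k m (final m k) A) = A"
    if "k \<le> m" "A \<in> X m" for k m A
    using that by (intro cmp_eqI[where N = m]) (simp_all add: act_initial_full act_final_full)
next
  fix m n k A B
  assume comp: "composable m n k A B"
  define N where "N = m + n - k"
  define D where "D = cmp m n k A B"
  have k: "k \<le> m" "k \<le> n" using comp by (simp_all add: composable_def)
  have N: "N + k = m + n" and le: "m \<le> N" "n \<le> N" using k by (auto simp: N_def)
  have D: "D \<in> X N" and A: "act m N (initial m) D = A" and B: "act n N (final N n) D = B"
    using glue[OF comp N] by (simp_all add: D_def)
  have N_diff: "N - n = m - k" using k N by simp
  note fold_defs = N_def[symmetric] D_def[symmetric]
  note maps = simplex_maps_intros
  {
    fix i assume i: "i \<le> n - k"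
    show "composable (m + i) n (k + i) (act (m + i) (m + n - k) (initial (m + i)) (cmp m n k A B)) B \<and>
      cmp (m + i) n (k + i) (act (m + i) (m + n - k) (initial (m + i)) (cmp m n k A B)) B =
        cmp m n k A B"
      unfolding fold_defs using i k N D B by (intro cmp_eqI) auto
  next
    fix j assume j: "j \<le> m - k"
    show "composable m (n + j) (k + j) A
        (act (n + j) (m + n - k) (final (m + n - k) (n + j)) (cmp m n k A B)) \<and>
      cmp m (n + j) (k + j) A
        (act (n + j) (m + n - k) (final (m + n - k) (n + j)) (cmp m n k A B)) =
        cmp m n k A B"
      unfolding fold_defs using j k N D A by (intro cmp_eqI) auto
  next
    fix i assume i: "i \<le> m - k"
    show "composable (m + 1) n k (act (m + 1) m (degen m i) A) B \<and>
      act (m + n - k + 1) (m + n - k) (degen (m + n - k) i) (cmp m n k A B) =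
        cmp (m + 1) n k (act (m + 1) m (degen m i) A) B"
    proof -
      have "act (m + 1) (N + 1) (initial (m + 1)) (act (N + 1) N (degen N i) D) =
          act (m + 1) m (degen m i) (act m N (initial m) D)"
        using i k le D by (intro act_square maps) (auto simp: ordinal_map_defs)
      moreover have "act n (N + 1) (final (N + 1) n) (act (N + 1) N (degen N i) D) =
          act n N (final N n) D"
        using i k le D N_diff by (intro act_act maps) (auto simp: ordinal_map_defs)
      moreover have "act (N + 1) N (degen N i) D \<in> X (N + 1)"
        using i le D by (intro act_in maps) auto
      ultimately show ?thesis
        unfolding fold_defs using k N A B cmp_eqI[of k "m + 1" n "N + 1"] by simp
    qed
  next
    fix i assume i: "m \<le> i" "i \<le> m + n - k"
    show "composable m (n + 1) k A (act (n + 1) n (degen n (i + k - m)) B) \<and>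
      act (m + n - k + 1) (m + n - k) (degen (m + n - k) i) (cmp m n k A B) =
        cmp m (n + 1) k A (act (n + 1) n (degen n (i + k - m)) B)"
    proof -
      have "act m (N + 1) (initial m) (act (N + 1) N (degen N i) D) = act m N (initial m) D"
        using i k le D by (intro act_act maps) (auto simp: ordinal_map_defs N_def)
      moreover have "act (n + 1) (N + 1) (final (N + 1) (n + 1)) (act (N + 1) N (degen N i) D) =
          act (n + 1) n (degen n (i + k - m)) (act n N (final N n) D)"
        using i k N le D by (intro act_square maps) (auto simp: ordinal_map_defs)
      moreover have "act (N + 1) N (degen N i) D \<in> X (N + 1)"
        using i D by (intro act_in maps) (auto simp: N_def)
      ultimately show ?thesis
        unfolding fold_defs using k N A B cmp_eqI[of k m "n + 1" "N + 1"] by simp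
    qed
  next
    fix i assume i: "m - k \<le> i" "i \<le> m"
    show "composable (m + 1) (n + 1) (k + 1)
        (act (m + 1) m (degen m i) A) (act (n + 1) n (degen n (i + k - m)) B) \<and>
      act (m + n - k + 1) (m + n - k) (degen (m + n - k) i) (cmp m n k A B) =
        cmp (m + 1) (n + 1) (k + 1)
          (act (m + 1) m (degen m i) A) (act (n + 1) n (degen n (i + k - m)) B)"
    proof -
      have "act (m + 1) (N + 1) (initial (m + 1)) (act (N + 1) N (degen N i) D) =
          act (m + 1) m (degen m i) (act m N (initial m) D)"
        using i k le D by (intro act_square maps) (auto simp: ordinal_map_defs)
      moreover have "act (n + 1) (N + 1) (final (N + 1) (n + 1)) (act (N + 1) N (degen N i) D) =
          act (n + 1) n (degen n (i + k - m)) (act n N (final N n) D)"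
        using i k N le D by (intro act_square maps) (auto simp: ordinal_map_defs)
      moreover have "act (N + 1) N (degen N i) D \<in> X (N + 1)"
        using i le D by (intro act_in maps) auto
      ultimately show ?thesis
        unfolding fold_defs using k N A B cmp_eqI[of "k + 1" "m + 1" "n + 1" "N + 1"] by simp
    qed
  next
    fix i assume i: "i < m - k"
    show "composable (m - 1) n k (act (m - 1) m (face m i) A) B \<and>
      act (m + n - k - 1) (m + n - k) (face (m + n - k) i) (cmp m n k A B) =
        cmp (m - 1) n k (act (m - 1) m (face m i) A) B"
    proof -
      have "act (m - 1) (N - 1) (initial (m - 1)) (act (N - 1) N (face N i) D) =
          act (m - 1) m (face m i) (act m N (initial m) D)"
        using i k le D by (intro act_square maps) (auto simp: ordinal_map_defs)
      moreover have "act n (N - 1) (final (N - 1) n) (act (N - 1) N (face N i) D) =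
          act n N (final N n) D"
        using i k N le D N_diff by (intro act_act maps) (auto simp: ordinal_map_defs)
      moreover have "act (N - 1) N (face N i) D \<in> X (N - 1)"
        using i le D by (intro act_in maps) auto
      moreover have "k \<le> m - 1" "N - 1 + k = m - 1 + n"
        using i k N by auto
      ultimately show ?thesis
        unfolding fold_defs using k A B cmp_eqI[of k "m - 1" n "N - 1"] by simp
    qed
  next
    fix i assume i: "m < i" "i \<le> m + n - k"
    show "composable m (n - 1) k A (act (n - 1) n (face n (i + k - m)) B) \<and>
      act (m + n - k - 1) (m + n - k) (face (m + n - k) i) (cmp m n k A B) =
        cmp m (n - 1) k A (act (n - 1) n (face n (i + k - m)) B)"
    proof -
      have n: "k \<le> n - 1" "N - 1 + k = m + (n - 1)" "1 \<le> n" "m \<le> N - 1" "n - 1 \<le> N - 1"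
        using i k by (auto simp: N_def)
      have "act m (N - 1) (initial m) (act (N - 1) N (face N i) D) = act m N (initial m) D"
        using i k n le D by (intro act_act maps) (auto simp: ordinal_map_defs)
      moreover have "act (n - 1) (N - 1) (final (N - 1) (n - 1)) (act (N - 1) N (face N i) D) =
          act (n - 1) n (face n (i + k - m)) (act n N (final N n) D)"
        using i k n N le D by (intro act_square maps) (auto simp: ordinal_map_defs Suc_diff_le)
      moreover have "act (N - 1) N (face N i) D \<in> X (N - 1)"
        using n le D by (intro act_in maps) auto
      ultimately show ?thesis
        unfolding fold_defs using k n A B cmp_eqI[of k m "n - 1" "N - 1"] by simp
    qed
  }
qed

end

section \<open>The nerve as a simplicial set\<close>

lemma on_ob_nerve_act: "i \<le> m \<Longrightarrow> on_ob (nerve_act m n f A) i = on_ob A (f i)"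
  by (simp add: nerve_act_def func_comp_def ord_func_def ord_cat_def compose_def)

lemma on_arr_nerve_act:
  "i \<le> j \<Longrightarrow> j \<le> m \<Longrightarrow> on_arr (nerve_act m n f A) (i, j) = on_arr A (f i, f j)"
  by (simp add: nerve_act_def func_comp_def ord_func_def ord_cat_def compose_def)

lemma nerve_extensional:
  assumes "A \<in> nerve C n"
  shows "on_ob A \<in> extensional {0..n}" "on_arr A \<in> extensional {(i, j). i \<le> j \<and> j \<le> n}"
  using assms by (simp_all add: nerve_def functors_def ord_cat_def PiE_iff)

lemma nerve_ob: "A \<in> nerve C n \<Longrightarrow> i \<le> n \<Longrightarrow> on_ob A i \<in> Ob C"
  by (simp add: nerve_def functors_def ord_cat_def PiE_iff)

lemma nerve_ident: "A \<in> nerve C n \<Longrightarrow> i \<le> n \<Longrightarrow> on_arr A (i, i) = Ident C (on_ob A i)"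
  by (simp add: nerve_def functors_def ord_cat_def PiE_iff)

lemma nerve_arr:
  assumes A: "A \<in> nerve C n" and ij: "i \<le> j" "j \<le> n"
  shows "on_arr A (i, j) \<in> Arr C"
    and "Dom C (on_arr A (i, j)) = on_ob A i"
    and "Cod C (on_arr A (i, j)) = on_ob A j"
proof -
  have "(i, j) \<in> Arr (ord_cat n)" using ij by (simp add: ord_cat_def)
  then have "on_arr A (i, j) \<in> Arr C \<and>
      Dom C (on_arr A (i, j)) = on_ob A (Dom (ord_cat n) (i, j)) \<and>
      Cod C (on_arr A (i, j)) = on_ob A (Cod (ord_cat n) (i, j))"
    using A unfolding nerve_def functors_def by blast
  then show "on_arr A (i, j) \<in> Arr C" "Dom C (on_arr A (i, j)) = on_ob A i"
    "Cod C (on_arr A (i, j)) = on_ob A j"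
    by (simp_all add: ord_cat_def)
qed

lemma nerve_comp:
  assumes A: "A \<in> nerve C n" and ijl: "i \<le> j" "j \<le> l" "l \<le> n"
  shows "on_arr A (i, l) = Comp C (on_arr A (j, l)) (on_arr A (i, j))"
proof -
  have "(i, j) \<in> Arr (ord_cat n)" "(j, l) \<in> Arr (ord_cat n)"
    "Cod (ord_cat n) (i, j) = Dom (ord_cat n) (j, l)"
    using ijl by (simp_all add: ord_cat_def)
  then have "on_arr A (Comp (ord_cat n) (j, l) (i, j)) =
      Comp C (on_arr A (j, l)) (on_arr A (i, j))"
    using A unfolding nerve_def functors_def by blast
  then show ?thesis by (simp add: ord_cat_def)
qed

lemma nerveI:
  assumes "on_ob A \<in> extensional {0..n}" "on_arr A \<in> extensional {(i, j). i \<le> j \<and> j \<le> n}"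
    and "\<And>i. i \<le> n \<Longrightarrow> on_ob A i \<in> Ob C"
    and "\<And>i. i \<le> n \<Longrightarrow> on_arr A (i, i) = Ident C (on_ob A i)"
    and arr: "\<And>i j. i \<le> j \<Longrightarrow> j \<le> n \<Longrightarrow> on_arr A (i, j) \<in> Arr C \<and>
      Dom C (on_arr A (i, j)) = on_ob A i \<and> Cod C (on_arr A (i, j)) = on_ob A j"
    and comp: "\<And>i j l. i \<le> j \<Longrightarrow> j \<le> l \<Longrightarrow> l \<le> n \<Longrightarrow>
      on_arr A (i, l) = Comp C (on_arr A (j, l)) (on_arr A (i, j))"
  shows "A \<in> nerve C n"
  unfolding nerve_def functors_def mem_Collect_eq
proof (intro conjI ballI impI)
  fix p q
  assume "p \<in> Arr (ord_cat n)" "q \<in> Arr (ord_cat n)" "Cod (ord_cat n) p = Dom (ord_cat n) q"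
  then obtain i j l where "p = (i, j)" "q = (j, l)" "i \<le> j" "j \<le> l" "l \<le> n"
    by (cases p, cases q) (simp add: ord_cat_def)
  then show "on_arr A (Comp (ord_cat n) q p) = Comp C (on_arr A q) (on_arr A p)"
    using comp[of i j l] by (simp add: ord_cat_def)
qed (use assms(1-4) arr in \<open>auto simp: ord_cat_def PiE_iff\<close>)

lemma nerve_functor_eqI:
  assumes "A \<in> nerve C n" "B \<in> nerve C n"
    and "\<And>i. i \<le> n \<Longrightarrow> on_ob A i = on_ob B i"
    and "\<And>i j. i \<le> j \<Longrightarrow> j \<le> n \<Longrightarrow> on_arr A (i, j) = on_arr B (i, j)"
  shows "A = B"
proof -
  have "on_ob A = on_ob B"
    using nerve_extensional(1)[OF assms(1)] nerve_extensional(1)[OF assms(2)] assms(3)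
    by (intro extensionalityI[of _ "{0..n}"]) auto
  moreover have "on_arr A = on_arr B"
    using nerve_extensional(2)[OF assms(1)] nerve_extensional(2)[OF assms(2)] assms(4)
    by (intro extensionalityI[of _ "{(i, j). i \<le> j \<and> j \<le> n}"]) auto
  ultimately show ?thesis by simp
qed

lemma nerve_act_in_nerve:
  assumes f: "f \<in> simplex_maps m n" and A: "A \<in> nerve C n"
  shows "nerve_act m n f A \<in> nerve C m"
proof (rule nerveI)
  show "on_ob (nerve_act m n f A) \<in> extensional {0..m}"
    "on_arr (nerve_act m n f A) \<in> extensional {(i, j). i \<le> j \<and> j \<le> m}"
    by (simp_all add: nerve_act_def func_comp_def ord_cat_def)
next
  fix i j l assume "i \<le> j" "j \<le> l" "l \<le> m"
  then show "on_arr (nerve_act m n f A) (i, l) =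
      Comp C (on_arr (nerve_act m n f A) (j, l)) (on_arr (nerve_act m n f A) (i, j))"
    using nerve_comp[OF A, of "f i" "f j" "f l"] simplex_maps_le[OF f] simplex_maps_mono[OF f]
    by (simp add: on_arr_nerve_act)
qed (use simplex_maps_le[OF f] simplex_maps_mono[OF f] in
  \<open>simp_all add: on_ob_nerve_act on_arr_nerve_act nerve_ob[OF A] nerve_ident[OF A] nerve_arr[OF A]\<close>)

lemma simplicial_set_nerve: "simplicial_set (nerve C) nerve_act"
proof
  show "nerve_act m n f A \<in> nerve C m" if "f \<in> simplex_maps m n" "A \<in> nerve C n" for f m n A
    using that by (rule nerve_act_in_nerve)
  show "nerve_act n n (\<lambda>v\<in>{0..n}. v) A = A" if A: "A \<in> nerve C n" for n A
  proof (rule nerve_functor_eqI[OF nerve_act_in_nerve[OF _ A] A])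
    show "(\<lambda>v\<in>{0..n}. v) \<in> simplex_maps n n"
      using initial_in_simplex_maps[of n n] by (simp add: initial_def)
  qed (simp_all add: on_ob_nerve_act on_arr_nerve_act)
  show "nerve_act l n (compose {0..l} g f) A = nerve_act l m f (nerve_act m n g A)"
    if "f \<in> simplex_maps l m" "g \<in> simplex_maps m n" "A \<in> nerve C n" for f l m g n A
    using that simplex_maps_le[OF that(1)] simplex_maps_mono[OF that(1)]
    by (intro nerve_functor_eqI[of _ C l] nerve_act_in_nerve compose_in_simplex_maps)
      (simp_all add: on_ob_nerve_act on_arr_nerve_act compose_eq)
qed

section \<open>Unique gluing in the nerve\<close>

lemma path_comp_cong:
  assumes "a i = b i" "\<And>j. i < j \<Longrightarrow> j \<le> i + l \<Longrightarrow> f j = g j"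
  shows "path_comp C a f i l = path_comp C b g i l"
  using assms by (induction l) auto

text \<open>A functor on \<open>[n]\<close> is determined by its vertices and steps, because it sends \<open>(i, j)\<close> to the
  composite of the steps from \<open>i\<close> to \<open>j\<close>.\<close>

lemma nerve_eqI:
  assumes A: "A \<in> nerve C n" and B: "B \<in> nerve C n"
    and ob: "\<And>i. i \<le> n \<Longrightarrow> on_ob A i = on_ob B i"
    and st: "\<And>i. 1 \<le> i \<Longrightarrow> i \<le> n \<Longrightarrow> step A i = step B i"
  shows "A = B"
proof (rule nerve_functor_eqI[OF A B ob])
  fix i j assume ij: "i \<le> j" "j \<le> n"
  have "on_arr (seq_func C n (on_ob A) (step A)) (i, j) =
      on_arr (seq_func C n (on_ob B) (step B)) (i, j)"
    using ij ob st by (auto simp: seq_func_def ord_cat_def intro!: path_comp_cong)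
  then show "on_arr A (i, j) = on_arr B (i, j)"
    by (simp add: seq_func_of_simplex[OF A] seq_func_of_simplex[OF B])
qed

lemma step_in_category:
  assumes "A \<in> nerve C n" "1 \<le> i" "i \<le> n"
  shows "step A i \<in> Arr C \<and> Dom C (step A i) = on_ob A (i - 1) \<and> Cod C (step A i) = on_ob A i"
  using assms by (simp add: nerve_arr[OF assms(1)] step_def)

lemma on_ob_nerve_act_initial: "i \<le> m \<Longrightarrow> on_ob (nerve_act m N (initial m) D) i = on_ob D i"
  by (simp add: on_ob_nerve_act initial_def)

lemma step_nerve_act_initial:
  "1 \<le> i \<Longrightarrow> i \<le> m \<Longrightarrow> step (nerve_act m N (initial m) D) i = step D i"
  by (cases i) (simp_all add: step_def on_arr_nerve_act initial_def)

lemma on_ob_nerve_act_final: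
  "i \<le> n \<Longrightarrow> on_ob (nerve_act n N (final N n) D) i = on_ob D (i + (N - n))"
  by (simp add: on_ob_nerve_act final_def)

lemma step_nerve_act_final:
  "1 \<le> i \<Longrightarrow> i \<le> n \<Longrightarrow> step (nerve_act n N (final N n) D) i = step D (i + (N - n))"
  by (cases i) (simp_all add: step_def on_arr_nerve_act final_def)

lemmas restriction_simps = on_ob_nerve_act_initial step_nerve_act_initial
  on_ob_nerve_act_final step_nerve_act_final

text \<open>A position \<open>i \<le> N\<close> beyond \<open>m\<close> is the position \<open>i - (N - n)\<close> of the final part: the gap
  \<open>N - n = m - k\<close> before that part is at most \<open>m\<close>, so the two parts share a vertex and no
  step is missed, even for \<open>k = 0\<close>.\<close>

lemma nerve_glue_unique:
  assumes k: "k \<le> m" and N: "N + k = m + n"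
    and D: "D \<in> nerve C N" "D' \<in> nerve C N"
    and init: "nerve_act m N (initial m) D = nerve_act m N (initial m) D'"
    and fin: "nerve_act n N (final N n) D = nerve_act n N (final N n) D'"
  shows "D = D'"
proof (rule nerve_eqI[OF D])
  show "on_ob D i = on_ob D' i" if "i \<le> N" for i
  proof (cases "i \<le> m")
    case True
    then show ?thesis using init by (metis on_ob_nerve_act_initial)
  next
    case False
    then have "i - (N - n) \<le> n" "i - (N - n) + (N - n) = i" using that k N by auto
    then show ?thesis using fin by (metis on_ob_nerve_act_final)
  qed
  show "step D i = step D' i" if "1 \<le> i" "i \<le> N" for i
  proof (cases "i \<le> m")
    case True
    then show ?thesis using init that by (metis step_nerve_act_initial)
  next
    case False
    then have "1 \<le> i - (N - n)" "i - (N - n) \<le> n" "i - (N - n) + (N - n) = i"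
      using that k N by auto
    then show ?thesis using fin by (metis step_nerve_act_final)
  qed
qed

text \<open>Agreement on the overlap is used twice: it makes the first step of \<open>B\<close> beyond the overlap
  start at the last vertex of \<open>A\<close>, so that the concatenation is a path, and it lets the
  positions up to \<open>m\<close>, which are read off from \<open>A\<close>, count as positions of \<open>B\<close> as well.\<close>

lemma nerve_cmp_glues:
  assumes "small_category C"
    and k: "k \<le> m" "k \<le> n" and N: "N + k = m + n"
    and A: "A \<in> nerve C m" and B: "B \<in> nerve C n"
    and overlap: "nerve_act k m (final m k) A = nerve_act k n (initial k) B"
  shows "nerve_cmp C m n k A B \<in> nerve C N"
    and "nerve_act m N (initial m) (nerve_cmp C m n k A B) = A"
    and "nerve_act n N (final N n) (nerve_cmp C m n k A B) = B"
proof -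
  interpret small_category C by fact
  let ?a = "\<lambda>i. if i \<le> m then on_ob A i else on_ob B (i - (m - k))"
  let ?f = "\<lambda>i. if i \<le> m then step A i else step B (i - (m - k))"
  let ?D = "nerve_cmp C m n k A B"
  have D_eq: "?D = seq_func C N ?a ?f"
    using N by (simp add: nerve_cmp_def flip: N)
  have le: "m \<le> N" "n \<le> N" and N_diff: "N - n = m - k" using k N by auto
  have ob_overlap: "on_ob A (v + (m - k)) = on_ob B v" if "v \<le> k" for v
    using that overlap by (metis on_ob_nerve_act_final on_ob_nerve_act_initial)
  have step_overlap: "step A (v + (m - k)) = step B v" if "1 \<le> v" "v \<le> k" for v
    using that overlap by (metis step_nerve_act_final step_nerve_act_initial)
  have ob: "?a i \<in> Ob C" if "i \<le> N" for i
  proof -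
    have "i - (m - k) \<le> n" using that N_diff by simp
    then show ?thesis using nerve_ob[OF A] nerve_ob[OF B] by simp
  qed
  have path: "?f i \<in> Arr C \<and> Dom C (?f i) = ?a (i - 1) \<and> Cod C (?f i) = ?a i"
    if i: "1 \<le> i" "i \<le> N" for i
  proof (cases "i \<le> m")
    case True
    then have "i - 1 \<le> m" by simp
    then show ?thesis using step_in_category[OF A i(1) True] True by simp
  next
    case False
    have "1 \<le> i - (m - k)" "i - (m - k) \<le> n" using False i N_diff k by auto
    note B_step = step_in_category[OF B this]
    have pred: "i - (m - k) - 1 = i - 1 - (m - k)" by simp
    show ?thesis
    proof (cases "i - 1 \<le> m")
      \<comment> \<open>the junction \<open>i = m + 1\<close>\<close>
      case True
      then have "i = m + 1" using False by simp
      then show ?thesis using B_step ob_overlap[of k] k by simp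
    next
      case beyond: False
      then show ?thesis using B_step pred False by simp
    qed
  qed
  note seq = seq_func_in_nerve[of N ?a ?f, OF ob path]
  show D: "?D \<in> nerve C N"
    unfolding D_eq by (rule seq(1))
  have D_ob: "on_ob ?D i = ?a i" if "i \<le> N" for i
    unfolding D_eq using that by (rule seq(2)[rotated -1])
  have D_step: "step ?D i = ?f i" if "1 \<le> i" "i \<le> N" for i
    unfolding D_eq using that by (rule seq(3)[rotated -2])
  show "nerve_act m N (initial m) ?D = A"
    using le
    by (intro nerve_eqI[OF nerve_act_in_nerve[OF _ D] A])
      (simp_all add: restriction_simps D_ob D_step initial_in_simplex_maps)
  show "nerve_act n N (final N n) ?D = B"
  proof (rule nerve_eqI[OF nerve_act_in_nerve[OF _ D] B])
    show "final N n \<in> simplex_maps n N" using le by (simp add: final_in_simplex_maps)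
    show "on_ob (nerve_act n N (final N n) ?D) i = on_ob B i" if "i \<le> n" for i
    proof -
      have "i + (m - k) \<le> N" "i + (m - k) \<le> m \<longleftrightarrow> i \<le> k" using that k N by auto
      then show ?thesis using that by (simp add: restriction_simps D_ob N_diff ob_overlap)
    qed
    show "step (nerve_act n N (final N n) ?D) i = step B i" if "1 \<le> i" "i \<le> n" for i
    proof -
      have "i + (m - k) \<le> N" "i + (m - k) \<le> m \<longleftrightarrow> i \<le> k" using that k N by auto
      then show ?thesis using that by (simp add: restriction_simps D_step N_diff step_overlap)
    qed
  qed
qed

theorem proposition3p1p2:
  fixes C :: "('o, 'm) cat"
  assumes "small_category C"
  shows "compository (nerve C) nerve_act (nerve_cmp C)"
proof -
  interpret simplicial_set "nerve C" nerve_act by (rule simplicial_set_nerve)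
  interpret unique_gluing "nerve C" nerve_act "nerve_cmp C"
  proof
    show "nerve_cmp C m n k A B \<in> nerve C N \<and>
        nerve_act m N (initial m) (nerve_cmp C m n k A B) = A \<and>
        nerve_act n N (final N n) (nerve_cmp C m n k A B) = B"
      if "composable m n k A B" "N + k = m + n" for m n k A B N
      using that nerve_cmp_glues[OF assms] by (simp add: composable_def)
  qed (rule nerve_glue_unique)
  show ?thesis by (rule compository)
qed

end
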